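(* Let $M=(E,r)$ be a $q$-matroid and let $\mathcal{Z}$ be its set of cyclic flats, viewed as a lattice with join $F\vee G=\mathrm{cl}(F+G)$, meet $F\wedge G=\mathrm{cyc}(F\cap G)$ and least element $0_{\mathcal{Z}}=\mathrm{cl}(\langle0\rangle)$. Then: (Z1) $r(0_{\mathcal{Z}})=0$; (Z2) for all $F,G\in\mathcal{Z}$ with $G<F$: $0<r(F)-r(G)<\dim F-\dim G$; (Z3) for all $F,G\in\mathcal{Z}$: $r(F)+r(G)\ge r(F\vee G)+r(F\wedge G)+\dim\big((F\cap G)/(F\wedge G)\big)$.
   Context: Let $q$ be a prime power and $E$ an $n$-dimensional $\mathbb{F}_q$-vector space. A $q$-matroid $(E,r)$ is a function $r$ from subspaces of $E$ to $\mathbb{Z}$ with (R1) $0\le r(A)\le\dim A$, (R2) $r(A)\le r(B)$ if $A\le B$, (R3) $r(A+B)+r(A\cap B)\le r(A)+r(B)$. The closure of $A$ is $\mathrm{cl}(A)=\sum x$ over all $1$-dimensional $x\le E$ with $r(A+x)=r(A)$. For $A\le E$, $\mathrm{cyc}(A)=\sum x$ over all $1$-dimensional $x\le A$ such that $r(B+x)=r(B)$ for every subspace $B\le A$ of codimension $1$ in $A$. A flat is a subspace $F$ with $r(F+x)>r(F)$ for every $1$-dimensional $x\not\le F$; a subspace $A$ is cyclic if $r(B)=r(A)$ for every $B\le A$ of codimension $1$ in $A$; a cyclic flat is a subspace that is both. *)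

theory Defs
  imports Complex_Main "HOL-Library.Set_Algebras"
begin

text \<open>
  The ground space \<open>E\<close> is the whole type \<open>'e\<close>, a finite-dimensional vector space over the finite
  field \<open>'k\<close>. The rank function is a function on all sets, but only its values
  on subspaces are constrained or used. The sum of two subspaces is the elementwise sum
  of sets from \<^theory>\<open>HOL-Library.Set_Algebras\<close>. The basis \<open>Basis\<close> is a parameter of the library's
  locale for finite-dimensional spaces; no definition below depends on it.
\<close>

locale q_matroid = finite_dimensional_vector_space scale Basis
  for scale :: "'k::{field,finite} \<Rightarrow> 'e::ab_group_add \<Rightarrow> 'e" (infixr \<open>*s\<close> 75)
    and Basis :: "'e set" +
  fixes r :: "'e set \<Rightarrow> int"
  assumes R1: "subspace A \<Longrightarrow> 0 \<le> r A \<and> r A \<le> int (dim A)"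
    and R2: "subspace A \<Longrightarrow> subspace B \<Longrightarrow> A \<subseteq> B \<Longrightarrow> r A \<le> r B"
    and R3: "subspace A \<Longrightarrow> subspace B \<Longrightarrow> r (A + B) + r (A \<inter> B) \<le> r A + r B"
begin

definition one_dim :: "'e set \<Rightarrow> bool"
  where "one_dim x \<longleftrightarrow> subspace x \<and> dim x = 1"

definition codim_one :: "'e set \<Rightarrow> 'e set \<Rightarrow> bool"
  where "codim_one B A \<longleftrightarrow> subspace B \<and> B \<subseteq> A \<and> dim B + 1 = dim A"

text \<open>
  The sum of a family of subspaces is the span of its union; in particular the empty
  sum is the zero space.
\<close>

definition cl :: "'e set \<Rightarrow> 'e set"
  where "cl A = span (\<Union>{x. one_dim x \<and> r (A + x) = r A})"

definition cyc :: "'e set \<Rightarrow> 'e set"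
  where "cyc A = span (\<Union>{x. one_dim x \<and> x \<subseteq> A \<and> (\<forall>B. codim_one B A \<longrightarrow> r (B + x) = r B)})"

definition is_flat :: "'e set \<Rightarrow> bool"
  where "is_flat F \<longleftrightarrow> subspace F \<and> (\<forall>x. one_dim x \<and> \<not> x \<subseteq> F \<longrightarrow> r (F + x) > r F)"

definition is_cyclic :: "'e set \<Rightarrow> bool"
  where "is_cyclic A \<longleftrightarrow> subspace A \<and> (\<forall>B. codim_one B A \<longrightarrow> r B = r A)"

definition cyclic_flats :: "'e set set"
  where "cyclic_flats = {F. is_flat F \<and> is_cyclic F}"

definition cf_join :: "'e set \<Rightarrow> 'e set \<Rightarrow> 'e set"
  where "cf_join F G = cl (F + G)"

definition cf_meet :: "'e set \<Rightarrow> 'e set \<Rightarrow> 'e set"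
  where "cf_meet F G = cyc (F \<inter> G)"

definition cf_zero :: "'e set"
  where "cf_zero = cl {0}"

text \<open>
  \<open>dim (V / W)\<close> for subspaces \<open>W \<subseteq> V\<close>. It is only applied to \<open>V = F \<inter> G\<close> and
  \<open>W = cyc (F \<inter> G)\<close>, which is contained in \<open>V\<close> as a sum of subspaces of \<open>V\<close>.
\<close>

definition quot_dim :: "'e set \<Rightarrow> 'e set \<Rightarrow> int"
  where "quot_dim V W = int (dim V) - int (dim W)"

lemma cyc_subset: "subspace A \<Longrightarrow> cyc A \<subseteq> A"
  unfolding cyc_def by (rule span_minimal) auto

end

end

theory Submission imports Defs begin

text \<open>
  The nullity \<open>dim A - r A\<close> is monotone and supermodular, since \<open>r\<close> is submodular and \<open>dim\<close> is
  modular. Hence the subspaces of \<open>A\<close> with the nullity of \<open>A\<close> are closed under intersection and have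
  a least element \<open>D\<close>. A hyperplane \<open>B\<close> of \<open>A\<close> with \<open>r B \<noteq> r A\<close> has the nullity of \<open>A\<close>, so it
  contains \<open>D\<close>; this gives \<open>D \<subseteq> cyc A\<close>, and so \<open>cyc A\<close> has the nullity of \<open>A\<close>.
  Dually, the superspaces of \<open>A\<close> of rank \<open>r A\<close> are closed under sums and have a largest element,
  which contains \<open>cl A\<close>; so \<open>r (cl A) \<le> r A\<close>. Then (Z3) is submodularity of \<open>r\<close> at \<open>F\<close>, \<open>G\<close>. In (Z2),
  the strict upper bound is monotonicity of the nullity from \<open>G\<close> to a hyperplane \<open>B \<supseteq> G\<close> of \<open>F\<close>,
  which has \<open>r B = r F\<close> because \<open>F\<close> is cyclic.
\<close>

context finite_dimensional_vector_space
begin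

lemma set_plus_eq: "A + B = {x + y |x y. x \<in> A \<and> y \<in> B}"
  unfolding set_plus_def by blast

lemma subspace_set_plus: "subspace A \<Longrightarrow> subspace B \<Longrightarrow> subspace (A + B)"
  unfolding set_plus_eq by (rule subspace_sums)

lemma dim_set_plus_Int: "subspace A \<Longrightarrow> subspace B \<Longrightarrow> dim (A + B) + dim (A \<inter> B) = dim A + dim B"
  unfolding set_plus_eq by (rule dim_sums_Int)

lemma subset_set_plus1: "subspace B \<Longrightarrow> A \<subseteq> A + B"
  and subset_set_plus2: "subspace A \<Longrightarrow> B \<subseteq> A + B"
  by (force simp: set_plus_eq dest: subspace_0)+

lemma set_plus_subset: "subspace C \<Longrightarrow> A \<subseteq> C \<Longrightarrow> B \<subseteq> C \<Longrightarrow> A + B \<subseteq> C"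
  by (auto simp: set_plus_eq intro: subspace_add)

lemma set_plus_absorb: "subspace A \<Longrightarrow> subspace B \<Longrightarrow> B \<subseteq> A \<Longrightarrow> A + B = A"
  by (simp add: set_plus_subset subset_antisym subset_set_plus1)

text \<open>A basis of \<open>A\<close> extends to a basis of \<open>B\<close>, and the added
  vectors span a complement.\<close>

lemma subspace_complement_within:
  assumes "subspace A" "subspace B" "A \<subseteq> B"
  obtains C where "subspace C" "A + C = B" "dim A + dim C = dim B"
proof -
  obtain S where S: "S \<subseteq> A" "independent S" "A \<subseteq> span S"
    by (metis basis_exists)
  obtain T where T: "S \<subseteq> T" "T \<subseteq> B" "independent T" "B \<subseteq> span T"
    using maximal_independent_subset_extend[of S B] S assms(3) by blast
  have A: "A = span S" and B: "B = span T"
    using S T assms by (auto simp: span_minimal subset_antisym)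
  have ind: "independent (T - S)"
    using T(3) by (rule independent_mono) auto
  have "A + span (T - S) = span (S \<union> (T - S))"
    unfolding A set_plus_eq span_Un ..
  also have "\<dots> = B" using T(1) B by (simp add: Un_absorb1)
  finally have sum: "A + span (T - S) = B" .
  have "dim A + dim (span (T - S)) = card S + card (T - S)"
    using S(2) ind by (simp add: A dim_eq_card_independent)
  also have "\<dots> = dim B"
    using T finiteI_independent[OF T(3)]
    by (simp add: B dim_eq_card_independent card_Diff_subset card_mono finite_subset)
  finally show ?thesis
    using that[OF subspace_span sum] by blast
qed

end

context q_matroid
begin

definition nullity :: "'e set \<Rightarrow> int"
  where "nullity A = int (dim A) - r A"

lemma rank_zero: "r {0} = 0"
  using R1[OF subspace_single_0] by simp

text \<open>Enlarging \<open>A\<close> by a complement \<open>C\<close> raises the rank by at most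
  \<open>r C\<close>, hence by at most \<open>dim C\<close>, which is the growth in
  dimension.\<close>

lemma nullity_mono:
  assumes "subspace A" "subspace B" "A \<subseteq> B"
  shows "nullity A \<le> nullity B"
proof -
  obtain C where C: "subspace C" "A + C = B" "dim A + dim C = dim B"
    using subspace_complement_within assms by blast
  have "r B + r (A \<inter> C) \<le> r A + r C"
    using R3[of A C] C assms by simp
  moreover have "0 \<le> r (A \<inter> C)" "r C \<le> int (dim C)"
    using R1 subspace_inter assms(1) C(1) by blast+
  ultimately show ?thesis
    using C(3) unfolding nullity_def by linarith
qed

lemma nullity_supermodular:
  assumes "subspace A" "subspace B"
  shows "nullity A + nullity B \<le> nullity (A + B) + nullity (A \<inter> B)"
  using R3[OF assms] dim_set_plus_Int[OF assms] unfolding nullity_def by linarith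

text \<open>Extend a basis \<open>S\<close> of \<open>G\<close> to a basis of \<open>F\<close> and
  drop one vector outside \<open>S\<close>.\<close>

lemma codim_one_exists:
  assumes "subspace G" "subspace F" "G \<subset> F"
  obtains B where "codim_one B F" "G \<subseteq> B"
proof -
  obtain S where S: "S \<subseteq> G" "independent S" "G \<subseteq> span S"
    by (metis basis_exists)
  obtain T where T: "S \<subseteq> T" "T \<subseteq> F" "independent T" "F \<subseteq> span T"
    using maximal_independent_subset_extend[of S F] S assms(3) by blast
  have F: "F = span T"
    using T assms by (simp add: span_minimal subset_antisym)
  have "S \<noteq> T"
    using span_minimal[OF S(1) assms(1)] F assms(3) by blast
  then obtain v where v: "v \<in> T" "v \<notin> S" using T(1) by blast
  let ?B = "span (T - {v})"
  have ind: "independent (T - {v})"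
    using T(3) by (rule independent_mono) auto
  have "dim ?B + 1 = dim F"
    unfolding F dim_span_eq_card_independent[OF ind] dim_span_eq_card_independent[OF T(3)]
    using v finiteI_independent[OF T(3)] by (metis Suc_eq_plus1 card_Suc_Diff1)
  moreover have "?B \<subseteq> F" unfolding F by (rule span_mono) auto
  ultimately have "codim_one ?B F" unfolding codim_one_def by simp
  moreover have "G \<subseteq> ?B"
    using S(3) span_mono[of S "T - {v}"] v(2) T(1) by blast
  ultimately show ?thesis by (rule that)
qed

lemma one_dim_span: "v \<noteq> 0 \<Longrightarrow> one_dim (span {v})"
  unfolding one_dim_def by simp

lemma rank_cl_le:
  assumes A: "subspace A"
  shows "r (cl A) \<le> r A"
proof -
  let ?P = "\<lambda>X. subspace X \<and> A \<subseteq> X \<and> r X = r A"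
  have "?P A" using A by simp
  moreover have "\<forall>X. ?P X \<longrightarrow> dim X < Suc dimension"
    using dim_subset_UNIV by (simp add: le_imp_less_Suc)
  ultimately obtain X where X: "?P X" and max: "\<And>Y. ?P Y \<Longrightarrow> dim Y \<le> dim X"
    using ex_has_greatest_nat[of ?P A dim "Suc dimension"] by (metis less_imp_le)
  \<comment> \<open>Submodularity at \<open>X\<close> and \<open>A + x\<close>, whose intersection
    contains \<open>A\<close>, keeps the rank of \<open>X + x\<close> at \<open>r A\<close>;
    maximality of \<open>dim X\<close> then forces \<open>X + x = X\<close>.\<close>
  have "x \<subseteq> X" if x: "one_dim x" "r (A + x) = r A" for x
  proof -
    have sx: "subspace x" using x(1) unfolding one_dim_def by simp
    have sAx: "subspace (A + x)" and sXx: "subspace (X + x)"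
      using A X sx by (auto intro: subspace_set_plus)
    have eq: "X + (A + x) = X + x"
      using set_plus_absorb[of X A] A X by (simp add: add.assoc[symmetric])
    have "A \<subseteq> X \<inter> (A + x)" using X subset_set_plus1[OF sx] by blast
    then have "r A \<le> r (X \<inter> (A + x))"
      using R2 A subspace_inter X sAx by blast
    moreover have "r (X + x) + r (X \<inter> (A + x)) \<le> r X + r (A + x)"
      using R3[of X "A + x"] X sAx eq by simp
    ultimately have "r (X + x) \<le> r A" using X x(2) by linarith
    moreover have XX: "X \<subseteq> X + x" using subset_set_plus1[OF sx] .
    ultimately have "?P (X + x)"
      using R2[of X "X + x"] X sXx by auto
    then have "X = X + x"
      using max subspace_dim_equal[of X "X + x"] X sXx XX by blast
    then show ?thesis using subset_set_plus2[of X x] X by auto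
  qed
  then have "cl A \<subseteq> X"
    unfolding cl_def using X by (intro span_minimal) auto
  then have "r (cl A) \<le> r X"
    using X by (intro R2) (auto simp: cl_def)
  then show ?thesis using X by simp
qed

text \<open>Equal nullity means that passing from \<open>A\<close> to \<open>cyc A\<close> lowers
  rank and dimension by the same amount, which accounts for the quotient term in (Z3).\<close>

lemma nullity_cyc:
  assumes A: "subspace A"
  shows "nullity (cyc A) = nullity A"
proof -
  let ?P = "\<lambda>X. subspace X \<and> X \<subseteq> A \<and> nullity X = nullity A"
  have "?P A" using A by simp
  then obtain D where D: "?P D" and min: "\<And>Y. ?P Y \<Longrightarrow> dim D \<le> dim Y"
    using ex_has_least_nat[of ?P A dim] by metis
  \<comment> \<open>The nullities of \<open>D + B\<close> and \<open>D \<inter> B\<close> are each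
    at most \<open>nullity A\<close> and sum to at least twice that, so both equal it. Minimality of
    \<open>dim D\<close> then gives \<open>D \<inter> B = D\<close>.\<close>
  have least: "D \<subseteq> B" if B: "?P B" for B
  proof -
    have s: "subspace (D \<inter> B)" "subspace (D + B)"
      using D B by (auto intro: subspace_inter subspace_set_plus)
    have "nullity (D + B) \<le> nullity A"
      using D B A s by (intro nullity_mono set_plus_subset) auto
    moreover have "nullity (D \<inter> B) \<le> nullity A"
      using D A s by (intro nullity_mono) auto
    ultimately have "?P (D \<inter> B)"
      using nullity_supermodular[of D B] D B s by auto
    then have "D \<inter> B = D"
      using min subspace_dim_equal[of "D \<inter> B" D] D s by blast
    then show ?thesis by blast
  qed
  have absorb: "r (B + x) = r B" if B: "codim_one B A" and x: "subspace x" "x \<subseteq> D" for B x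
  proof -
    have sB: "subspace B" "B \<subseteq> A" "dim B + 1 = dim A"
      using B unfolding codim_one_def by auto
    have sBx: "subspace (B + x)" using sB(1) x(1) by (rule subspace_set_plus)
    have BA: "r B \<le> r A" using sB A R2 by blast
    show ?thesis
    proof (cases "r B = r A")
      case True
      have "r (B + x) \<le> r A"
        using A D x sB sBx by (intro R2 set_plus_subset) auto
      moreover have "r B \<le> r (B + x)"
        using R2 sB(1) sBx subset_set_plus1[OF x(1)] by blast
      ultimately show ?thesis using True by simp
    next
      case False
      \<comment> \<open>The rank is an integer, so it drops by at least 1 while the dimension drops
        by exactly 1.\<close>
      then have "nullity A \<le> nullity B"
        using BA sB(3) unfolding nullity_def by linarith
      then have "D \<subseteq> B"
        using nullity_mono[of B A] sB A by (intro least) auto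
      then show ?thesis using set_plus_absorb[of B x] sB x by auto
    qed
  qed
  have "v \<in> cyc A" if v: "v \<in> D" for v
  \<comment> \<open>The zero vector spans no line, so it is treated apart; any other
    \<open>v\<close> spans one of the lines summed in \<open>cyc A\<close>.\<close>
  proof (cases "v = 0")
    case True
    then show ?thesis by (simp add: cyc_def span_zero)
  next
    case False
    have "span {v} \<subseteq> D" using v D by (intro span_minimal) auto
    then have "one_dim (span {v}) \<and> span {v} \<subseteq> A \<and>
        (\<forall>B. codim_one B A \<longrightarrow> r (B + span {v}) = r B)"
      using one_dim_span[OF False] absorb D by auto
    moreover have "v \<in> span {v}" by (simp add: span_base)
    ultimately show ?thesis unfolding cyc_def by (blast intro: span_base)
  qed
  then have "nullity D \<le> nullity (cyc A)"
    using D by (intro nullity_mono) (auto simp: cyc_def)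
  moreover have "nullity (cyc A) \<le> nullity A"
    using A cyc_subset by (intro nullity_mono) (auto simp: cyc_def)
  ultimately show ?thesis using D by simp
qed

lemma rank_cf_zero: "r cf_zero = 0"
  using rank_cl_le[OF subspace_single_0] R1[of cf_zero] rank_zero
  unfolding cf_zero_def cl_def by simp

text \<open>A single line of \<open>F\<close> outside the flat \<open>G\<close> already raises the
  rank.\<close>

lemma flat_rank_less:
  assumes "is_flat G" "subspace F" "G \<subset> F"
  shows "r G < r F"
proof -
  obtain v where v: "v \<in> F" "v \<notin> G" using assms(3) by blast
  have sG: "subspace G" using assms(1) unfolding is_flat_def by simp
  have "v \<noteq> 0" using v(2) sG subspace_0 by blast
  moreover have "\<not> span {v} \<subseteq> G" using v(2) span_base[of v "{v}"] by blast
  ultimately have "r G < r (G + span {v})"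
    using assms(1) one_dim_span unfolding is_flat_def by blast
  also have "\<dots> \<le> r F"
    using assms v sG by (intro R2 set_plus_subset subspace_set_plus span_minimal) auto
  finally show ?thesis .
qed

lemma cyclic_nullity_less:
  assumes "is_cyclic F" "subspace G" "G \<subset> F"
  shows "nullity G < nullity F"
proof -
  have "subspace F" using assms(1) unfolding is_cyclic_def by simp
  then obtain B where B: "codim_one B F" "G \<subseteq> B"
    using codim_one_exists assms by blast
  have "nullity G \<le> nullity B"
    using B assms(2) unfolding codim_one_def by (intro nullity_mono) auto
  \<comment> \<open>\<open>B\<close> has the rank of \<open>F\<close> but dimension one less, so its
    nullity is exactly one less; this is the source of strictness.\<close>
  also have "\<dots> < nullity F"
    using B(1) assms(1) unfolding is_cyclic_def codim_one_def nullity_def by force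
  finally show ?thesis .
qed

text \<open>By \<open>nullity_cyc\<close>, the meet and quotient terms add up to
  \<open>r (F \<inter> G)\<close>, and the join term is at most \<open>r (F + G)\<close>. What
  remains is (R3), so arbitrary subspaces are allowed.\<close>

lemma rank_join_meet:
  assumes "subspace F" "subspace G"
  shows "r (cf_join F G) + r (cf_meet F G) + quot_dim (F \<inter> G) (cf_meet F G) \<le> r F + r G"
  using R3[OF assms] rank_cl_le[OF subspace_set_plus[OF assms]] nullity_cyc[OF subspace_inter[OF assms]]
  unfolding cf_join_def cf_meet_def quot_dim_def nullity_def by linarith

end

theorem theorem3p2:
  fixes scale :: "'k::{field,finite} \<Rightarrow> 'e::ab_group_add \<Rightarrow> 'e"
    and Basis :: "'e set"
    and r :: "'e set \<Rightarrow> int"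
  assumes "q_matroid scale Basis r"
  shows "r (q_matroid.cf_zero scale r) = 0
    \<and> (\<forall>F \<in> q_matroid.cyclic_flats scale r. \<forall>G \<in> q_matroid.cyclic_flats scale r. G \<subset> F \<longrightarrow>
         0 < r F - r G
       \<and> r F - r G < int (vector_space.dim scale F) - int (vector_space.dim scale G))
    \<and> (\<forall>F \<in> q_matroid.cyclic_flats scale r. \<forall>G \<in> q_matroid.cyclic_flats scale r.
         r F + r G \<ge> r (q_matroid.cf_join scale r F G) + r (q_matroid.cf_meet scale r F G)
           + q_matroid.quot_dim scale (F \<inter> G) (q_matroid.cf_meet scale r F G))"
proof -
  interpret q_matroid scale Basis r by fact
  show ?thesis
  proof (intro conjI ballI impI)
    show "r cf_zero = 0" by (rule rank_cf_zero)
  next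
    fix F G assume FG: "F \<in> cyclic_flats" "G \<in> cyclic_flats"
    then have flat: "is_flat G" and cyc: "is_cyclic F" and s: "subspace F" "subspace G"
      unfolding cyclic_flats_def is_flat_def by auto
    show "r (cf_join F G) + r (cf_meet F G) + quot_dim (F \<inter> G) (cf_meet F G) \<le> r F + r G"
      using s by (rule rank_join_meet)
    assume "G \<subset> F"
    show "0 < r F - r G"
      using flat_rank_less[OF flat s(1) \<open>G \<subset> F\<close>] by simp
    show "r F - r G < int (dim F) - int (dim G)"
      using cyclic_nullity_less[OF cyc s(2) \<open>G \<subset> F\<close>] unfolding nullity_def by simp
  qed
qed

end
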